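(* Suppose $\vdash^n_\Gamma a:t:\rho$ holds for some context $\Gamma$ with domain $\{x_1,\dots,x_k\}$, where $x_i$ has type $\rho_i$. Then for all $\ell\le n$ and all closed lambda trees $t_1:\rho_1,\dots,t_k:\rho_k$: if $\Vdash^\ell \Gamma(x_i):t_i:\rho_i$ for every $i$, then $\Vdash^\ell a : t[t_1/x_1,\dots,t_k/x_k]:\rho$.
   Context: Setting: $\Sigma'$ ranked alphabet, $\Sigma=\Sigma'\cup\{\mathcal R,\beta\}$ with $\mathcal R,\beta$ unary; $\mathfrak A$ a fixed trivial automaton over $\Sigma$ (maximal arity $N$) with finite state set $Q$ and $\delta\colon Q\times\Sigma\to\mathcal P((Q\cup\{\ast\})^N)$, $\delta(q,\mathfrak f)\subseteq Q^{\mathrm{ar}(\mathfrak f)}\times\{\ast\}^{N-\mathrm{ar}(\mathfrak f)}$. A run up to level $n$ starting in $q$ on a $\Sigma$-term is a map $r$ from the nodes at distance $\le n$ from the root to $Q$, root $\mapsto q$, such that whenever an $\mathfrak f$-node $p$ and its children $p_1,\dots,p_{\mathrm{ar}(\mathfrak f)}$ are in the domain, $(r(p_1),\dots,r(p_{\mathrm{ar}(\mathfrak f)}),\ast,\dots,\ast)\in\delta(r(p),\mathfrak f)$. Lambda trees: possibly infinite simply-typed trees built from variables, $\lambda x^\rho$, application and constants $\mathfrak f\in\Sigma'$ of type $\iota^{\mathrm{ar}(\mathfrak f)}\to\iota$. Continuous normal form: for closed $t,\vec t$ with $t\vec t:\iota$, coinductively $\mathrm{cn}(rs;\vec t)=\mathcal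 R(\mathrm{cn}(r;s,\vec t))$, $\mathrm{cn}(\lambda x.r;s,\vec t)=\beta(\mathrm{cn}(r[s/x];\vec t))$, $\mathrm{cn}(\mathfrak f;\vec t)=\mathfrak f(t_1^\beta,\dots,t_n^\beta)$, $t^\beta=\mathrm{cn}(t;())$. Semantics: $\llbracket\iota\rrbracket=\mathcal P(Q)$, $\llbracket\rho\to\sigma\rrbracket$ = all functions; $\sqsubseteq$ inclusion on $\mathcal P(Q)$, pointwise on functions. Liftings for $f\in\llbracket\vec\rho\to\iota\rrbracket$: $\mathcal R(f)(\vec a)=\{q\mid\delta(q,\mathcal R)\cap(f\vec a\times\{\ast\}^{N-1})\neq\emptyset\}$, $\beta(f)$ likewise with $\delta(q,\beta)$. A context $\Gamma$ is a finite map from variables $x^\sigma$ to $\llbracket\sigma\rrbracket$; $\Gamma^a_x$ is the update. Proof system $\vdash^n_\Gamma a:t:\rho$ by induction on $n$: (i) $n=0$ always; (ii) $\vdash^n_\Gamma a:x:\rho$ if $a\sqsubseteq\Gamma(x)$; (iii) $\vdash^{n+1}_\Gamma a:st:\sigma$ if there are $f,u$ with $a\sqsubseteq\mathcal R(fu)$, $\vdash^n_\Gamma f:s:\rho\to\sigma$, $\vdash^n_\Gamma u:t:\rho$; (iv) $\vdash^{n+1}_\Gamma f:\lambda x^\rho.s:\rho\to\sigma$ if for each $a\in\llbracket\rho\rrbracket$ some $b_a$ has $fa\sqsubseteq\beta(b_a)$ and $\vdash^n_{\Gamma^a_x}b_a:s:\sigma$; (v) $\vdash^n_\Gamma f:\mathfrak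 f:\iota^{\mathrm{ar}(\mathfrak f)}\to\iota$ if for all $\vec a\in\mathcal P(Q)^{\mathrm{ar}(\mathfrak f)}$, $f\vec a\subseteq\{q\mid\delta(q,\mathfrak f)\cap(a_1\times\dots\times a_{\mathrm{ar}(\mathfrak f)}\times\{\ast\}^{N-\mathrm{ar}(\mathfrak f)})\ne\emptyset\}$. Truth relation (by induction on the type): for $f\in\llbracket\vec\rho\to\iota\rrbracket$ and closed $t:\vec\rho\to\iota$, $\Vdash^n f:t:\vec\rho\to\iota$ iff for all $\ell\le n$, all $\vec a\in\llbracket\vec\rho\rrbracket$ and all closed $\vec r:\vec\rho$ with $\Vdash^\ell a_i:r_i:\rho_i$ for all $i$, every $q\in f\vec a$ is such that $\mathfrak A$ has a run up to level $\ell$ on $\mathrm{cn}(t;\vec r)$ starting in $q$.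
   Formalization: In a run up to level n the transition condition is imposed only at nodes at distance less than n, so nullary leaves at distance exactly n are unconstrained; read literally, the claim fails at n=0 for a nullary constant c with δ(q,c) empty. *)

theory Defs
  imports "HOL-Library.FSet" "HOL-Library.FuncSet"
begin

section \<open>Alphabet and automaton\<close>

text \<open>The alphabet \<open>\<Sigma>' \<union> {\<R>, \<beta>}\<close>, with the two additional symbols distinct from all letters of
  \<open>\<Sigma>'\<close>.\<close>

datatype 'c symbol = Letter 'c | SymR | SymBeta

text \<open>The letters \<open>\<Sigma>'\<close> and the states \<open>Q\<close> are sets rather than whole types, so that either may
  be empty.  \<open>None\<close> plays the role of \<open>\<ast>\<close>, and \<open>(Q \<union> {\<ast>})\<^sup>N\<close> consists of lists of length \<open>N\<close>.\<close>

record ('c, 'q) automaton =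
  letters :: "'c set"
  arity :: "'c \<Rightarrow> nat"
  states :: "'q set"
  trans :: "'q \<Rightarrow> 'c symbol \<Rightarrow> 'q option list set"

fun sym_arity :: "('c, 'q) automaton \<Rightarrow> 'c symbol \<Rightarrow> nat" where
  "sym_arity A (Letter c) = arity A c"
| "sym_arity A SymR = 1"
| "sym_arity A SymBeta = 1"

definition alphabet :: "('c, 'q) automaton \<Rightarrow> 'c symbol set" where
  "alphabet A = insert SymR (insert SymBeta (Letter ` letters A))"

definition max_arity :: "('c, 'q) automaton \<Rightarrow> nat" where
  "max_arity A = Max (sym_arity A ` alphabet A)"

text \<open>\<open>(q\<^sub>1, \<dots>, q\<^sub>m, \<ast>, \<dots>, \<ast>)\<close> with \<open>N\<close> components.  Hence \<open>pad A ` listset [B\<^sub>1, \<dots>, B\<^sub>m]\<close>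
  is \<open>B\<^sub>1 \<times> \<dots> \<times> B\<^sub>m \<times> {\<ast>} \<times> \<dots> \<times> {\<ast>}\<close>, a set of \<open>N\<close>-tuples if \<open>m \<le> N\<close>.\<close>

definition pad :: "('c, 'q) automaton \<Rightarrow> 'q list \<Rightarrow> 'q option list" where
  "pad A qs = map Some qs @ replicate (max_arity A - length qs) None"

text \<open>Finiteness of the set of arities is what makes the maximal arity exist; a finite alphabet
  is a special case.\<close>

definition trivial_automaton :: "('c, 'q) automaton \<Rightarrow> bool" where
  "trivial_automaton A \<longleftrightarrow>
     finite (arity A ` letters A) \<and> finite (states A) \<and>
     (\<forall>q \<in> states A. \<forall>F \<in> alphabet A.
        trans A q F \<subseteq> pad A ` listset (replicate (sym_arity A F) (states A)))"

text \<open>\<open>{q. \<delta>(q, F) \<inter> (B\<^sub>1 \<times> \<dots> \<times> B\<^sub>m \<times> {\<ast>} \<times> \<dots> \<times> {\<ast>}) \<noteq> {}}\<close>\<close>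

definition pre :: "('c, 'q) automaton \<Rightarrow> 'c symbol \<Rightarrow> 'q set list \<Rightarrow> 'q set" where
  "pre A F Bs = {q \<in> states A. trans A q F \<inter> pad A ` listset Bs \<noteq> {}}"


section \<open>Terms over the alphabet and runs\<close>

codatatype 'c sterm = Node (root: "'c symbol") (children: "'c sterm list")

text \<open>A node is given by its address, the list of child indices on the way from the root.\<close>

primrec subterm_at :: "'c sterm \<Rightarrow> nat list \<Rightarrow> 'c sterm option" where
  "subterm_at T [] = Some T"
| "subterm_at T (i # p) =
     (if i < length (children T) then subterm_at (children T ! i) p else None)"

text \<open>A run is a function on all addresses of which only the values at nodes of \<open>T\<close> at distance at
  most \<open>n\<close> from the root matter.  The transition condition is imposed at the nodes at distance
  \<^emph>\<open>less than\<close> \<open>n\<close>, i.e. at those whose level of children still belongs to the domain.  This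
  matters only for nullary symbols: the leaves at distance exactly \<open>n\<close> are unconstrained, so that
  a run up to level \<open>0\<close> exists from every state.\<close>

definition is_run ::
  "('c, 'q) automaton \<Rightarrow> nat \<Rightarrow> 'q \<Rightarrow> 'c sterm \<Rightarrow> (nat list \<Rightarrow> 'q) \<Rightarrow> bool" where
  "is_run A n q T r \<longleftrightarrow>
     r [] = q \<and>
     (\<forall>p. subterm_at T p \<noteq> None \<and> length p \<le> n \<longrightarrow> r p \<in> states A) \<and>
     (\<forall>p F Ts. subterm_at T p = Some (Node F Ts) \<and> length p < n \<longrightarrow>
        pad A (map (\<lambda>i. r (p @ [i])) [0..<sym_arity A F]) \<in> trans A (r p) F)"

definition has_run :: "('c, 'q) automaton \<Rightarrow> nat \<Rightarrow> 'q \<Rightarrow> 'c sterm \<Rightarrow> bool" where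
  "has_run A n q T \<longleftrightarrow> (\<exists>r. is_run A n q T r)"


section \<open>Lambda trees\<close>

datatype ty = Iota | Arr ty ty

fun arg_tys :: "ty \<Rightarrow> ty list" where
  "arg_tys Iota = []"
| "arg_tys (Arr \<rho> \<sigma>) = \<rho> # arg_tys \<sigma>"

definition letter_ty :: "('c, 'q) automaton \<Rightarrow> 'c \<Rightarrow> ty" where
  "letter_ty A c = (Arr Iota ^^ arity A c) Iota"

text \<open>A variable \<open>x\<^sup>\<rho>\<close> is the pair of its name and its type.  An application node carries the type of
  the application: without it, an infinite spine of applications would not determine its type.\<close>

type_synonym 'v tvar = "'v \<times> ty"

codatatype ('v, 'c) ltree =
    Var "'v tvar"
  | Lam "'v tvar" "('v, 'c) ltree"
  | App ty "('v, 'c) ltree" "('v, 'c) ltree"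
  | Con 'c

coinductive typed :: "('c, 'q) automaton \<Rightarrow> ('v, 'c) ltree \<Rightarrow> ty \<Rightarrow> bool" for A where
  "typed A (Var (x, \<rho>)) \<rho>"
| "typed A s \<sigma> \<Longrightarrow> typed A (Lam (x, \<rho>) s) (Arr \<rho> \<sigma>)"
| "typed A s (Arr \<rho> \<sigma>) \<Longrightarrow> typed A t \<rho> \<Longrightarrow> typed A (App \<sigma> s t) \<sigma>"
| "c \<in> letters A \<Longrightarrow> typed A (Con c) (letter_ty A c)"

lemma typed_unique: "typed A t \<rho> \<Longrightarrow> typed A t \<sigma> \<Longrightarrow> \<rho> = \<sigma>"
proof (induction \<rho> arbitrary: t \<sigma>)
  case Iota
  then show ?case by (auto elim: typed.cases)
next
  case (Arr \<rho>1 \<rho>2)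
  from Arr.prems(1) show ?case
  proof cases
    case (2 s x)
    from Arr.prems(2) 2(1) obtain \<tau> where "\<sigma> = Arr \<rho>1 \<tau>" "typed A s \<tau>"
      by (auto elim: typed.cases)
    then show ?thesis using Arr.IH(2) 2 by blast
  qed (use Arr.prems(2) in \<open>auto elim: typed.cases\<close>)
qed

inductive free_in :: "'v tvar \<Rightarrow> ('v, 'c) ltree \<Rightarrow> bool" for x where
  "free_in x (Var x)"
| "free_in x s \<Longrightarrow> x \<noteq> y \<Longrightarrow> free_in x (Lam y s)"
| "free_in x s \<Longrightarrow> free_in x (App \<sigma> s t)"
| "free_in x t \<Longrightarrow> free_in x (App \<sigma> s t)"

definition FV :: "('v, 'c) ltree \<Rightarrow> 'v tvar set" where
  "FV t = {x. free_in x t}"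

definition closed_tree :: "('v, 'c) ltree \<Rightarrow> bool" where
  "closed_tree t \<longleftrightarrow> FV t = {}"

text \<open>Simultaneous substitution.  Only closed trees are ever substituted, so no variable can be
  captured and bound variables need not be renamed.\<close>

primcorec subst ::
  "('v tvar \<rightharpoonup> ('v, 'c) ltree) \<Rightarrow> ('v, 'c) ltree \<Rightarrow> ('v, 'c) ltree" where
  "subst \<theta> t = (case t of
       Var x \<Rightarrow> (case \<theta> x of None \<Rightarrow> Var x | Some u \<Rightarrow> u)
     | Lam x s \<Rightarrow> Lam x (subst (\<theta>(x := None)) s)
     | App \<sigma> r s \<Rightarrow> App \<sigma> (subst \<theta> r) (subst \<theta> s)
     | Con c \<Rightarrow> Con c)"

text \<open>The continuous normal form \<open>cn(t; ts)\<close>.  The two undefined cases do not arise for closed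
  \<open>t\<close> and \<open>ts\<close> such that \<open>t\<close> applied to \<open>ts\<close> has type \<open>\<iota>\<close>.\<close>

primcorec cn :: "('v, 'c) ltree \<Rightarrow> ('v, 'c) ltree list \<Rightarrow> 'c sterm" where
  "cn t ts = (case t of
       App \<sigma> r s \<Rightarrow> Node SymR [cn r (s # ts)]
     | Lam x r \<Rightarrow> (case ts of
           s # ts' \<Rightarrow> Node SymBeta [cn (subst [x \<mapsto> s] r) ts']
         | [] \<Rightarrow> undefined)
     | Con c \<Rightarrow> Node (Letter c) (map (\<lambda>s. cn s []) ts)
     | Var x \<Rightarrow> undefined)"

lemma cn_simps:
  "cn (App \<sigma> r s) ts = Node SymR [cn r (s # ts)]"
  "cn (Lam x r) (s # ts) = Node SymBeta [cn (subst [x \<mapsto> s] r) ts]"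
  "cn (Con c) ts = Node (Letter c) (map (\<lambda>s. cn s []) ts)"
  by (subst cn.code, simp)+


section \<open>Semantics\<close>

text \<open>The interpretations of all types live in one type of hereditarily finite values: a state set,
  or the graph of a function.  Interpretations are finite because \<open>Q\<close> is, so finite graphs suffice
  to have all functions in the interpretation of an arrow type; see \<open>bij_betw_sem_Arr\<close> below.\<close>

datatype 'q val = VSet (the_set: "'q set") | VFun (graph: "('q val \<times> 'q val) fset")

fun sem :: "('c, 'q) automaton \<Rightarrow> ty \<Rightarrow> 'q val set" where
  "sem A Iota = VSet ` Pow (states A)"
| "sem A (Arr \<rho> \<sigma>) =
     {VFun g | g. fset g \<subseteq> sem A \<rho> \<times> sem A \<sigma> \<and> (\<forall>a \<in> sem A \<rho>. \<exists>!b. (a, b) \<in> fset g)}"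

definition app :: "'q val \<Rightarrow> 'q val \<Rightarrow> 'q val" where
  "app f a = (THE b. (a, b) \<in> fset (graph f))"

definition apps :: "'q val \<Rightarrow> 'q val list \<Rightarrow> 'q val" where
  "apps f as = foldl app f as"

definition vlam :: "('c, 'q) automaton \<Rightarrow> ty \<Rightarrow> ('q val \<Rightarrow> 'q val) \<Rightarrow> 'q val" where
  "vlam A \<rho> h = VFun (Abs_fset ((\<lambda>a. (a, h a)) ` sem A \<rho>))"

fun below :: "('c, 'q) automaton \<Rightarrow> ty \<Rightarrow> 'q val \<Rightarrow> 'q val \<Rightarrow> bool" where
  "below A Iota a b \<longleftrightarrow> the_set a \<subseteq> the_set b"
| "below A (Arr \<rho> \<sigma>) f g \<longleftrightarrow> (\<forall>a \<in> sem A \<rho>. below A \<sigma> (app f a) (app g a))"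

text \<open>The liftings \<open>\<R>(f)\<close> and \<open>\<beta>(f)\<close>, for \<open>F\<close> being \<open>SymR\<close> or \<open>SymBeta\<close>; the lemma \<open>apps_lift\<close>
  below gives their values at all argument vectors.\<close>

fun lift :: "('c, 'q) automaton \<Rightarrow> 'c symbol \<Rightarrow> ty \<Rightarrow> 'q val \<Rightarrow> 'q val" where
  "lift A F Iota a = VSet (pre A F [the_set a])"
| "lift A F (Arr \<rho> \<sigma>) f = vlam A \<rho> (\<lambda>a. lift A F \<sigma> (app f a))"


lemma finite_sem:
  assumes "finite (states A)"
  shows "finite (sem A \<rho>)"
proof (induction \<rho>)
  case Iota
  then show ?case using assms by simp
next
  case (Arr \<rho> \<sigma>)
  let ?P = "Pow (sem A \<rho> \<times> sem A \<sigma>)"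
  have "finite ?P" using Arr by simp
  moreover have "sem A (Arr \<rho> \<sigma>) \<subseteq> (\<lambda>S. VFun (Abs_fset S)) ` ?P"
  proof
    fix f assume "f \<in> sem A (Arr \<rho> \<sigma>)"
    then obtain g where "f = VFun g" "fset g \<in> ?P" by auto
    then show "f \<in> (\<lambda>S. VFun (Abs_fset S)) ` ?P"
      by (auto simp: fset_inverse intro!: image_eqI[of _ _ "fset g"])
  qed
  ultimately show ?case by (meson finite_surj)
qed

lemma graph_vlam:
  assumes "finite (states A)"
  shows "fset (graph (vlam A \<rho> h)) = (\<lambda>a. (a, h a)) ` sem A \<rho>"
  using finite_sem[OF assms, of \<rho>] by (simp add: vlam_def Abs_fset_inverse)

lemma app_vlam:
  assumes "finite (states A)" "a \<in> sem A \<rho>"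
  shows "app (vlam A \<rho> h) a = h a"
  using assms by (auto simp: app_def graph_vlam intro!: the_equality)

lemma vlam_in_sem:
  assumes "finite (states A)" "\<And>a. a \<in> sem A \<rho> \<Longrightarrow> h a \<in> sem A \<sigma>"
  shows "vlam A \<rho> h \<in> sem A (Arr \<rho> \<sigma>)"
proof -
  have "vlam A \<rho> h = VFun (graph (vlam A \<rho> h))" by (simp add: vlam_def)
  moreover have "fset (graph (vlam A \<rho> h)) \<subseteq> sem A \<rho> \<times> sem A \<sigma>"
    using assms by (auto simp: graph_vlam)
  moreover have "\<forall>a \<in> sem A \<rho>. \<exists>!b. (a, b) \<in> fset (graph (vlam A \<rho> h))"
    using assms by (auto simp: graph_vlam)
  ultimately show ?thesis by auto
qed

lemma graph_sem:
  assumes "f \<in> sem A (Arr \<rho> \<sigma>)"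
  shows "f = VFun (graph f)" "a \<in> sem A \<rho> \<Longrightarrow> app f a \<in> sem A \<sigma>"
    "fset (graph f) = (\<lambda>a. (a, app f a)) ` sem A \<rho>"
proof -
  obtain g where g: "f = VFun g" "fset g \<subseteq> sem A \<rho> \<times> sem A \<sigma>"
    and ex: "\<And>a. a \<in> sem A \<rho> \<Longrightarrow> \<exists>!b. (a, b) \<in> fset g"
    using assms by auto
  have in_graph: "(a, app f a) \<in> fset g" if "a \<in> sem A \<rho>" for a
    using theI'[OF ex[OF that]] g(1) by (simp add: app_def)
  show "f = VFun (graph f)" using g(1) by simp
  show "a \<in> sem A \<rho> \<Longrightarrow> app f a \<in> sem A \<sigma>" using in_graph g(2) by blast
  have "(a, b) \<in> fset g \<longleftrightarrow> a \<in> sem A \<rho> \<and> b = app f a" for a b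
  proof
    assume ab: "(a, b) \<in> fset g"
    then have "a \<in> sem A \<rho>" using g(2) by blast
    then show "a \<in> sem A \<rho> \<and> b = app f a" using ex in_graph ab by metis
  qed (use in_graph in simp)
  moreover have "graph f = g" using g(1) by simp
  ultimately show "fset (graph f) = (\<lambda>a. (a, app f a)) ` sem A \<rho>"
    by (intro set_eqI) (simp only: split_paired_all image_iff prod.inject, blast)
qed

lemma bij_betw_sem_Arr:
  assumes "finite (states A)"
  shows "bij_betw (\<lambda>f. restrict (app f) (sem A \<rho>)) (sem A (Arr \<rho> \<sigma>)) (sem A \<rho> \<rightarrow>\<^sub>E sem A \<sigma>)"
  unfolding bij_betw_def
proof
  show "inj_on (\<lambda>f. restrict (app f) (sem A \<rho>)) (sem A (Arr \<rho> \<sigma>))"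
  proof (rule inj_onI)
    fix f g
    assume f: "f \<in> sem A (Arr \<rho> \<sigma>)" and g: "g \<in> sem A (Arr \<rho> \<sigma>)"
      and eq: "restrict (app f) (sem A \<rho>) = restrict (app g) (sem A \<rho>)"
    have "app f a = app g a" if "a \<in> sem A \<rho>" for a
      using fun_cong[OF eq, of a] that by simp
    then have "fset (graph f) = fset (graph g)"
      unfolding graph_sem(3)[OF f] graph_sem(3)[OF g] by (auto simp: image_iff)
    then show "f = g" using graph_sem(1)[OF f] graph_sem(1)[OF g] by (metis fset_inject)
  qed
  show "(\<lambda>f. restrict (app f) (sem A \<rho>)) ` sem A (Arr \<rho> \<sigma>) = sem A \<rho> \<rightarrow>\<^sub>E sem A \<sigma>"
  proof (intro equalityI subsetI)
    fix h assume "h \<in> (\<lambda>f. restrict (app f) (sem A \<rho>)) ` sem A (Arr \<rho> \<sigma>)"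
    then obtain f where f: "f \<in> sem A (Arr \<rho> \<sigma>)" and h: "h = restrict (app f) (sem A \<rho>)"
      by blast
    show "h \<in> sem A \<rho> \<rightarrow>\<^sub>E sem A \<sigma>"
      unfolding h by (rule restrict_PiE_iff[THEN iffD2]) (use graph_sem(2)[OF f] in blast)
  next
    fix h assume h: "h \<in> sem A \<rho> \<rightarrow>\<^sub>E sem A \<sigma>"
    then have "vlam A \<rho> h \<in> sem A (Arr \<rho> \<sigma>)"
      using assms by (auto intro!: vlam_in_sem simp del: sem.simps)
    moreover have "h = restrict (app (vlam A \<rho> h)) (sem A \<rho>)"
    proof
      fix a show "h a = restrict (app (vlam A \<rho> h)) (sem A \<rho>) a"
        using PiE_arb[OF h] app_vlam[OF assms] by (cases "a \<in> sem A \<rho>") simp_all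
    qed
    ultimately show "h \<in> (\<lambda>f. restrict (app f) (sem A \<rho>)) ` sem A (Arr \<rho> \<sigma>)" by blast
  qed
qed

lemma lift_in_sem:
  assumes "finite (states A)" "f \<in> sem A \<rho>"
  shows "lift A F \<rho> f \<in> sem A \<rho>"
  using assms(2)
proof (induction \<rho> arbitrary: f)
  case Iota
  then show ?case by (auto simp: pre_def)
next
  case (Arr \<rho> \<sigma>)
  have "vlam A \<rho> (\<lambda>a. lift A F \<sigma> (app f a)) \<in> sem A (Arr \<rho> \<sigma>)"
    using graph_sem(2)[OF Arr.prems] Arr.IH(2) by (intro vlam_in_sem[OF assms(1)]) blast
  then show ?case by (simp only: lift.simps)
qed

lemma apps_lift:
  assumes "finite (states A)" "as \<in> listset (map (sem A) (arg_tys \<rho>))"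
  shows "apps (lift A F \<rho> f) as = VSet (pre A F [the_set (apps f as)])"
  using assms(2)
proof (induction \<rho> arbitrary: f as)
  case Iota
  then show ?case by (simp add: apps_def)
next
  case (Arr \<rho> \<sigma>)
  then obtain b bs where "as = b # bs" "b \<in> sem A \<rho>" "bs \<in> listset (map (sem A) (arg_tys \<sigma>))"
    by (auto simp: set_Cons_def)
  then show ?case
    using Arr.IH(2)[of bs "app f b"] assms(1) by (simp add: apps_def app_vlam)
qed


section \<open>The proof system\<close>

type_synonym ('v, 'q) ctx = "'v tvar \<rightharpoonup> 'q val"

definition is_ctx :: "('c, 'q) automaton \<Rightarrow> ('v, 'q) ctx \<Rightarrow> bool" where
  "is_ctx A \<Gamma> \<longleftrightarrow>
     finite (dom \<Gamma>) \<and> (\<forall>x \<rho> a. \<Gamma> (x, \<rho>) = Some a \<longrightarrow> a \<in> sem A \<rho>)"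

text \<open>The well-formedness presupposed by writing \<open>\<turnstile>\<^sub>\<Gamma> a : t : \<rho>\<close>.\<close>

definition wf_judgement ::
  "('c, 'q) automaton \<Rightarrow> ('v, 'q) ctx \<Rightarrow> 'q val \<Rightarrow> ('v, 'c) ltree \<Rightarrow> ty \<Rightarrow> bool" where
  "wf_judgement A \<Gamma> a t \<rho> \<longleftrightarrow>
     is_ctx A \<Gamma> \<and> a \<in> sem A \<rho> \<and> typed A t \<rho> \<and> FV t \<subseteq> dom \<Gamma>"

inductive derives ::
  "('c, 'q) automaton \<Rightarrow> nat \<Rightarrow> ('v, 'q) ctx \<Rightarrow> 'q val \<Rightarrow> ('v, 'c) ltree \<Rightarrow> ty \<Rightarrow> bool"
  for A where
  zero: "wf_judgement A \<Gamma> a t \<rho> \<Longrightarrow> derives A 0 \<Gamma> a t \<rho>"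
| var: "wf_judgement A \<Gamma> a (Var (x, \<rho>)) \<rho> \<Longrightarrow> \<Gamma> (x, \<rho>) = Some b \<Longrightarrow> below A \<rho> a b \<Longrightarrow>
    derives A n \<Gamma> a (Var (x, \<rho>)) \<rho>"
| app: "wf_judgement A \<Gamma> a (App \<sigma> s t) \<sigma> \<Longrightarrow>
    below A \<sigma> a (lift A SymR \<sigma> (app f u)) \<Longrightarrow>
    derives A n \<Gamma> f s (Arr \<rho> \<sigma>) \<Longrightarrow> derives A n \<Gamma> u t \<rho> \<Longrightarrow>
    derives A (Suc n) \<Gamma> a (App \<sigma> s t) \<sigma>"
| lam: "wf_judgement A \<Gamma> f (Lam (x, \<rho>) s) (Arr \<rho> \<sigma>) \<Longrightarrow>
    \<forall>a \<in> sem A \<rho>. \<exists>b. below A \<sigma> (app f a) (lift A SymBeta \<sigma> b) \<and>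
      derives A n (\<Gamma>((x, \<rho>) \<mapsto> a)) b s \<sigma> \<Longrightarrow>
    derives A (Suc n) \<Gamma> f (Lam (x, \<rho>) s) (Arr \<rho> \<sigma>)"
| con: "wf_judgement A \<Gamma> f (Con c) (letter_ty A c) \<Longrightarrow>
    \<forall>Bs. length Bs = arity A c \<and> set Bs \<subseteq> Pow (states A) \<longrightarrow>
      the_set (apps f (map VSet Bs)) \<subseteq> pre A (Letter c) Bs \<Longrightarrow>
    derives A n \<Gamma> f (Con c) (letter_ty A c)"


section \<open>The truth relation\<close>

lemma size_arg_tys: "\<sigma> \<in> set (arg_tys \<rho>) \<Longrightarrow> size \<sigma> < size \<rho>"
  by (induction \<rho>) auto

text \<open>The relation is defined only for semantic values of the given type and closed trees of that type;
  it is false elsewhere.\<close>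

function truth ::
  "('c, 'q) automaton \<Rightarrow> nat \<Rightarrow> 'q val \<Rightarrow> ('v, 'c) ltree \<Rightarrow> ty \<Rightarrow> bool" where
  "truth A n f t \<rho> \<longleftrightarrow>
     f \<in> sem A \<rho> \<and> typed A t \<rho> \<and> closed_tree t \<and>
     (\<forall>l \<le> n. \<forall>as rs.
        length as = length (arg_tys \<rho>) \<and> length rs = length (arg_tys \<rho>) \<and>
        (\<forall>i < length (arg_tys \<rho>).
           as ! i \<in> sem A (arg_tys \<rho> ! i) \<and>
           typed A (rs ! i) (arg_tys \<rho> ! i) \<and> closed_tree (rs ! i) \<and>
           truth A l (as ! i) (rs ! i) (arg_tys \<rho> ! i)) \<longrightarrow>
        (\<forall>q \<in> the_set (apps f as). has_run A l q (cn t rs)))"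
  by pat_completeness (simp only: prod.inject)
termination
  by (relation "measure (\<lambda>(A, n, f, t, \<rho>). size \<rho>)") (simp_all add: size_arg_tys)

declare truth.simps [simp del]

end

theory Submission
  imports Defs
begin

text \<open>Induction on the derivation.  One use of rule \<open>app\<close> or \<open>lam\<close> costs one unit of the level
  \<open>n\<close>, and it adds exactly one node, labelled \<open>\<R>\<close> or \<open>\<beta>\<close>, on top of the continuous normal form;
  the liftings are defined such that a run of level \<open>m\<close> below that node extends to one of level
  \<open>m + 1\<close>.  In the case of an abstraction, \<open>s\<theta>[r/x] = s(\<theta>[x \<mapsto> r])\<close> because only closed trees are
  substituted.\<close>

section \<open>Substitution\<close>

lemma subst_simps:
  "subst \<theta> (Var x) = (case \<theta> x of None \<Rightarrow> Var x | Some u \<Rightarrow> u)"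
  "subst \<theta> (Lam x s) = Lam x (subst (\<theta>(x := None)) s)"
  "subst \<theta> (App \<sigma> r s) = App \<sigma> (subst \<theta> r) (subst \<theta> s)"
  "subst \<theta> (Con c) = Con c"
  by (subst subst.code, simp)+

text \<open>Coinduction, since trees may be infinite. The map is general because passing under a
  binder deletes the bound variable from it.\<close>

lemma subst_not_free: "(\<And>x. free_in x t \<Longrightarrow> \<theta> x = None) \<Longrightarrow> subst \<theta> t = t"
proof (coinduction arbitrary: \<theta> t rule: ltree.coinduct_strong)
  case Eq_ltree
  then have free: "\<theta> y = None" if "free_in y t" for y using that by blast
  show ?case
  proof (cases t)
    case (Var x)
    then have "\<theta> x = None" using free[of x] by (simp add: free_in.intros(1))
    then show ?thesis using Var by (simp add: subst_simps)
  next
    case (Lam x s)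
    have "(\<theta>(x := None)) y = None" if "free_in y s" for y
      using free[of y] Lam that by (auto intro: free_in.intros)
    then show ?thesis unfolding Lam by (auto simp: subst_simps simp del: fun_upd_apply)
  qed (use free in \<open>auto simp: subst_simps intro: free_in.intros\<close>)
qed

lemma subst_closed: "closed_tree t \<Longrightarrow> subst \<theta> t = t"
  by (rule subst_not_free) (auto simp: closed_tree_def FV_def)

text \<open>The trees that \<open>\<theta>\<close> inserts are closed, so \<open>\<phi>\<close>
  leaves them alone; \<open>++\<close> gives precedence to its right operand, hence to
  \<open>\<theta>\<close>.\<close>

lemma subst_subst:
  assumes "\<And>u. u \<in> ran \<theta> \<Longrightarrow> closed_tree u"
  shows "subst \<phi> (subst \<theta> t) = subst (\<phi> ++ \<theta>) t"
  using assms
proof (coinduction arbitrary: \<phi> \<theta> t rule: ltree.coinduct_strong)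
  case Eq_ltree
  show ?case
  proof (cases t)
    \<comment> \<open>Both sides are the same tree, possibly an inserted one, whose subtrees fall
      under the equality alternative of the strong rule.\<close>
    case (Var x)
    then show ?thesis
      using Eq_ltree by (cases "\<theta> x") (auto simp: subst_simps subst_closed map_add_def ranI)
  next
    case (Lam x s)
    have "(\<phi> ++ \<theta>)(x := None) = \<phi>(x := None) ++ \<theta>(x := None)"
      by (auto simp: map_add_def fun_eq_iff split: option.split)
    moreover have "\<And>u. u \<in> ran (\<theta>(x := None)) \<Longrightarrow> closed_tree u"
      using Eq_ltree by (auto simp: ran_def split: if_splits)
    ultimately show ?thesis unfolding Lam by (auto simp: subst_simps)
  qed (use Eq_ltree in \<open>auto simp: subst_simps\<close>)
qed

text \<open>Split off because every case of the next induction meets it: a tree of any shape may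
  have been inserted for a variable.\<close>

lemma free_in_subst_Var:
  fixes \<theta> :: "'v tvar \<rightharpoonup> ('v, 'c) ltree"
  assumes "free_in x (subst \<theta> (Var z))" "\<And>u. u \<in> ran \<theta> \<Longrightarrow> closed_tree u"
  shows "x = z \<and> \<theta> x = None"
proof (cases "\<theta> z")
  case None
  then have "free_in x (Var z :: ('v, 'c) ltree)" using assms(1) by (simp add: subst_simps)
  then have "x = z" by cases auto
  then show ?thesis using None by simp
next
  case (Some u)
  then show ?thesis
    using assms(1) assms(2)[OF ranI[of \<theta>, OF Some]] by (cases x) (simp add: subst_simps closed_tree_def FV_def)
qed

text \<open>Rule induction on \<open>free_in\<close> follows the finite path to a free occurrence,
  so it also works for infinite trees.\<close>

lemma free_in_subst:
  assumes "free_in x (subst \<theta> t)" "\<And>u. u \<in> ran \<theta> \<Longrightarrow> closed_tree u"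
  shows "free_in x t \<and> \<theta> x = None"
  using assms
proof (induction "subst \<theta> t" arbitrary: \<theta> t rule: free_in.induct)
  case 1
  have fr: "free_in x (subst \<theta> t)" unfolding 1(1)[symmetric] by (rule free_in.intros)
  show ?case
  proof (cases t)
    case (Var z)
    then show ?thesis using free_in_subst_Var[of x \<theta> z] fr 1(2) Var by (auto intro: free_in.intros)
  qed (use 1 in \<open>auto simp: subst_simps\<close>)
next
  case (2 s y)
  have fr: "free_in x (subst \<theta> t)" unfolding 2(4)[symmetric] using 2(1,3) by (rule free_in.intros)
  show ?case
  proof (cases t)
    case (Var z)
    then show ?thesis using free_in_subst_Var[of x \<theta> z] fr 2(5) Var by (auto intro: free_in.intros)
  next
    case (Lam z s')
    \<comment> \<open>The induction hypothesis is used for the map without \<open>y\<close>; as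
      \<open>x \<noteq> y\<close>, what it says about that map at \<open>x\<close> holds for
      \<open>\<theta>\<close>.\<close>
    then have s: "s = subst (\<theta>(y := None)) s'" "z = y" using 2 by (auto simp: subst_simps)
    moreover have "\<And>u. u \<in> ran (\<theta>(y := None)) \<Longrightarrow> closed_tree u"
      using 2(5) by (auto simp: ran_def split: if_splits)
    ultimately show ?thesis using 2(2)[OF s(1)] 2(3) Lam by (auto intro: free_in.intros)
  qed (use 2 in \<open>auto simp: subst_simps\<close>)
next
  case (3 s \<sigma> r)
  have fr: "free_in x (subst \<theta> t)" unfolding 3(3)[symmetric] using 3(1) by (rule free_in.intros)
  show ?case
  proof (cases t)
    case (Var z)
    then show ?thesis using free_in_subst_Var[of x \<theta> z] fr 3(4) Var by (auto intro: free_in.intros)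
  qed (use 3 in \<open>auto simp: subst_simps intro: free_in.intros\<close>)
next
  case (4 r \<sigma> s)
  have fr: "free_in x (subst \<theta> t)" unfolding 4(3)[symmetric] using 4(1) by (rule free_in.intros)
  show ?case
  proof (cases t)
    case (Var z)
    then show ?thesis using free_in_subst_Var[of x \<theta> z] fr 4(4) Var by (auto intro: free_in.intros)
  qed (use 4 in \<open>auto simp: subst_simps intro: free_in.intros\<close>)
qed

lemma closed_subst:
  assumes "\<And>u. u \<in> ran \<theta> \<Longrightarrow> closed_tree u" "FV t \<subseteq> dom \<theta>"
  shows "closed_tree (subst \<theta> t)"
  using free_in_subst[of _ \<theta> t] assms by (fastforce simp: closed_tree_def FV_def)

lemma typed_subst:
  assumes "typed A t \<rho>" "\<And>x \<sigma> u. \<theta> (x, \<sigma>) = Some u \<Longrightarrow> typed A u \<sigma>"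
  shows "typed A (subst \<theta> t) \<rho>"
  using assms
proof (coinduction arbitrary: t \<rho> \<theta>)
  case typed
  from typed(1) show ?case
  proof cases
    case (1 x)
    show ?thesis
    proof (cases "\<theta> (x, \<rho>)")
      case None
      then show ?thesis using 1 by (simp add: subst_simps)
    next
      case (Some u)
      \<comment> \<open>The subtrees of the inserted tree \<open>u\<close> enter through the
        alternative of the coinduction rule that they are typed already.\<close>
      then have "typed A u \<rho>" using typed(2) by blast
      then show ?thesis using Some 1 by cases (auto simp: subst_simps)
    qed
  next
    case (2 s \<sigma> x \<rho>')
    have "\<And>y \<tau> u. (\<theta>((x, \<rho>') := None)) (y, \<tau>) = Some u \<Longrightarrow> typed A u \<tau>"
      using typed(2) by (auto split: if_splits)
    with 2(3) have "\<exists>t' \<theta>'. subst (\<theta>((x, \<rho>') := None)) s = subst \<theta>' t' \<and> typed A t' \<sigma> \<and>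
        (\<forall>y \<tau> u. \<theta>' (y, \<tau>) = Some u \<longrightarrow> typed A u \<tau>)"
      by blast
    with 2 show ?thesis by (simp add: subst_simps del: fun_upd_apply)
  next
    case (3 s \<rho>' t)
    with typed(2) show ?thesis by (simp add: subst_simps) blast
  next
    case (4 c)
    then show ?thesis by (auto simp: subst_simps)
  qed
qed

section \<open>Runs\<close>

lemma listset_nth:
  "xs \<in> listset Bs \<longleftrightarrow> length xs = length Bs \<and> (\<forall>i < length Bs. xs ! i \<in> Bs ! i)"
proof (induction Bs arbitrary: xs)
  case (Cons B Bs)
  then show ?case by (cases xs) (auto simp: set_Cons_def nth_Cons' less_Suc_eq_0_disj)
qed simp

lemma has_run_0: "q \<in> states A \<Longrightarrow> has_run A 0 q T"
  unfolding has_run_def is_run_def by (rule exI[of _ "\<lambda>_. q"]) simp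

lemma has_run_mono: "has_run A n q T \<Longrightarrow> m \<le> n \<Longrightarrow> has_run A m q T"
  unfolding has_run_def
proof (elim exE, rule exI)
  fix r assume "is_run A n q T r" "m \<le> n"
  then show "is_run A m q T r"
    unfolding is_run_def by (meson le_trans less_le_trans)
qed

text \<open>Gluing: membership in \<open>pre\<close> yields a transition tuple, and runs from its
  components on the children are combined below a new root, which raises every distance by
  one.\<close>

lemma has_run_Node:
  assumes q: "q \<in> pre A F Bs"
    and len: "length Bs = sym_arity A F" "length Ts = length Bs"
    and runs: "\<And>i q'. i < length Bs \<Longrightarrow> q' \<in> Bs ! i \<Longrightarrow> has_run A m q' (Ts ! i)"
  shows "has_run A (Suc m) q (Node F Ts)"
proof -
  obtain qs where qs: "pad A qs \<in> trans A q F" "qs \<in> listset Bs" and "q \<in> states A"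
    using q by (auto simp: pre_def)
  have len_qs: "length qs = length Bs" using qs(2) by (simp add: listset_nth)
  have "\<exists>r. is_run A m (qs ! i) (Ts ! i) r" if "i < length Bs" for i
    using runs[OF that] qs(2) that by (auto simp: listset_nth has_run_def)
  then obtain r where r: "\<And>i. i < length Bs \<Longrightarrow> is_run A m (qs ! i) (Ts ! i) (r i)"
    by metis
  \<comment> \<open>The root gets \<open>q\<close>; below it, the first index of an address selects
    the run on that child.\<close>
  define r' where "r' p = (case p of [] \<Rightarrow> q | i # p' \<Rightarrow> r i p')" for p
  have "is_run A (Suc m) q (Node F Ts) r'"
    unfolding is_run_def
  proof (intro conjI allI impI)
    show "r' [] = q" by (simp add: r'_def)
  next
    fix p assume "subterm_at (Node F Ts) p \<noteq> None \<and> length p \<le> Suc m"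
    then show "r' p \<in> states A"
      using \<open>q \<in> states A\<close> r len(2)
      by (cases p) (auto simp: r'_def is_run_def split: if_splits)
  next
    fix p G Us
    assume p: "subterm_at (Node F Ts) p = Some (Node G Us) \<and> length p < Suc m"
    show "pad A (map (\<lambda>i. r' (p @ [i])) [0..<sym_arity A G]) \<in> trans A (r' p) G"
    proof (cases p)
      case Nil
      \<comment> \<open>The runs start in the components of \<open>qs\<close>, so the root uses the
        transition chosen above.\<close>
      have "map (\<lambda>i. r i []) [0..<sym_arity A F] = qs"
        using r len_qs len(1) by (auto simp: is_run_def intro: nth_equalityI)
      then show ?thesis using Nil p qs(1) by (simp add: r'_def)
    next
      case (Cons i p')
      then show ?thesis
        using p r[of i] len(2) by (auto simp: r'_def is_run_def split: if_splits)
    qed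
  qed
  then show ?thesis unfolding has_run_def by blast
qed

lemma has_run_Node1:
  assumes "q \<in> pre A F [B]" "sym_arity A F = 1" "\<And>q'. q' \<in> B \<Longrightarrow> has_run A m q' T"
  shows "has_run A (Suc m) q (Node F [T])"
  using assms by (intro has_run_Node[of q A F "[B]"]) auto

section \<open>Semantic values\<close>

lemma apps_Cons [simp]: "apps f (a # as) = apps (app f a) as"
  by (simp add: apps_def)

lemma apps_in_sem:
  assumes "f \<in> sem A \<rho>" "as \<in> listset (map (sem A) (arg_tys \<rho>))"
  shows "apps f as \<in> sem A Iota"
  using assms
proof (induction \<rho> arbitrary: f as)
  case Iota
  then show ?case by (simp add: apps_def)
next
  case (Arr \<rho> \<sigma>)
  then obtain b bs where "as = b # bs" "b \<in> sem A \<rho>" "bs \<in> listset (map (sem A) (arg_tys \<sigma>))"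
    by (auto simp: set_Cons_def)
  then show ?case using Arr.IH(2)[of "app f b" bs] graph_sem(2)[OF Arr.prems(1)] by simp
qed

lemma below_apps:
  assumes "below A \<rho> f g" "as \<in> listset (map (sem A) (arg_tys \<rho>))"
  shows "the_set (apps f as) \<subseteq> the_set (apps g as)"
  using assms
proof (induction \<rho> arbitrary: f g as)
  case Iota
  then show ?case by (simp add: apps_def)
next
  case (Arr \<rho> \<sigma>)
  then obtain b bs where "as = b # bs" "b \<in> sem A \<rho>" "bs \<in> listset (map (sem A) (arg_tys \<sigma>))"
    by (auto simp: set_Cons_def)
  then show ?case using Arr.IH(2)[of "app f b" "app g b" bs] Arr.prems(1) by simp
qed

lemma arg_tys_letter_ty: "arg_tys (letter_ty A c) = replicate (arity A c) Iota"
proof -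
  have "arg_tys ((Arr Iota ^^ k) Iota) = replicate k Iota" for k by (induction k) auto
  then show ?thesis by (simp add: letter_ty_def)
qed

section \<open>The truth relation\<close>

text \<open>Recursive in the vectors, so that an argument can be pushed in front or split off by
  simplification; \<open>truths_nth\<close> gives the link to the indexed form in
  \<open>truth\<close>.\<close>

fun truths ::
  "('c, 'q) automaton \<Rightarrow> nat \<Rightarrow> 'q val list \<Rightarrow> ('v, 'c) ltree list \<Rightarrow> ty list \<Rightarrow> bool" where
  "truths A n [] [] [] \<longleftrightarrow> True"
| "truths A n (a # as) (r # rs) (\<rho> # \<rho>s) \<longleftrightarrow> truth A n a r \<rho> \<and> truths A n as rs \<rho>s"
| "truths A n _ _ _ \<longleftrightarrow> False"

lemma truths_nth:
  "truths A n as rs \<rho>s \<longleftrightarrow>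
     length as = length \<rho>s \<and> length rs = length \<rho>s \<and>
     (\<forall>i < length \<rho>s. truth A n (as ! i) (rs ! i) (\<rho>s ! i))"
  by (induction A n as rs \<rho>s rule: truths.induct) (auto simp: nth_Cons' less_Suc_eq_0_disj)

text \<open>Unfolding of \<open>truth\<close> with \<open>truths\<close> for the arguments;
  \<open>wf\<close> restores membership, typing and closedness of each argument pair.\<close>

lemma truth_iff:
  fixes t :: "('v, 'c) ltree"
  shows "truth A n f t \<rho> \<longleftrightarrow>
     f \<in> sem A \<rho> \<and> typed A t \<rho> \<and> closed_tree t \<and>
     (\<forall>l \<le> n. \<forall>as rs. truths A l as rs (arg_tys \<rho>) \<longrightarrow>
        (\<forall>q \<in> the_set (apps f as). has_run A l q (cn t rs)))"
proof -
  have wf: "a \<in> sem A \<sigma> \<and> typed A r \<sigma> \<and> closed_tree r"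
    if "truth A l a r \<sigma>" for l a \<sigma> and r :: "('v, 'c) ltree"
    using that by (subst (asm) truth.simps) blast
  show ?thesis
    by (subst truth.simps, unfold truths_nth) (use wf in blast)
qed

lemma truthD:
  assumes "truth A n f t \<rho>"
  shows "f \<in> sem A \<rho>" "typed A t \<rho>" "closed_tree t"
    "l \<le> n \<Longrightarrow> truths A l as rs (arg_tys \<rho>) \<Longrightarrow> q \<in> the_set (apps f as) \<Longrightarrow>
      has_run A l q (cn t rs)"
  using assms by (subst (asm) truth_iff; blast)+

lemma truth_mono: "truth A n f t \<rho> \<Longrightarrow> m \<le> n \<Longrightarrow> truth A m f t \<rho>"
  by (subst (asm) truth_iff, subst truth_iff) (meson le_trans)

lemma truths_mono: "truths A n as rs \<rho>s \<Longrightarrow> m \<le> n \<Longrightarrow> truths A m as rs \<rho>s"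
  by (auto simp: truths_nth intro: truth_mono)

lemma truths_in_sem: "truths A n as rs \<rho>s \<Longrightarrow> as \<in> listset (map (sem A) \<rho>s)"
  by (auto simp: truths_nth listset_nth dest: truthD(1))

text \<open>Level \<open>0\<close> comes for free, since there a run is just a state.\<close>

lemma truthI:
  fixes t :: "('v, 'c) ltree"
  assumes "f \<in> sem A \<rho>" "typed A t \<rho>" "closed_tree t"
    and Suc: "\<And>m as rs q. Suc m \<le> n \<Longrightarrow> truths A (Suc m) as rs (arg_tys \<rho>) \<Longrightarrow>
      q \<in> the_set (apps f as) \<Longrightarrow> has_run A (Suc m) q (cn t rs)"
  shows "truth A n f t \<rho>"
  unfolding truth_iff[of A n f t \<rho>]
proof (intro conjI allI impI ballI)
  fix l as q and rs :: "('v, 'c) ltree list"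
  assume l: "l \<le> n" and as: "truths A l as rs (arg_tys \<rho>)" and q: "q \<in> the_set (apps f as)"
  show "has_run A l q (cn t rs)"
  proof (cases l)
    case 0
    have "q \<in> states A" using apps_in_sem[OF assms(1) truths_in_sem[OF as]] q by auto
    then show ?thesis using 0 has_run_0 by simp
  next
    case (Suc m)
    then show ?thesis using assms(4) l as q by simp
  qed
qed (use assms in simp_all)

text \<open>At each argument vector, \<open>a\<close> yields only states from which \<open>b\<close>
  already guarantees runs.\<close>

lemma truth_below:
  fixes t :: "('v, 'c) ltree"
  assumes "truth A n b t \<rho>" "below A \<rho> a b" "a \<in> sem A \<rho>"
  shows "truth A n a t \<rho>"
proof (rule truthI)
  fix m as q and rs :: "('v, 'c) ltree list"
  assume "Suc m \<le> n" "truths A (Suc m) as rs (arg_tys \<rho>)" "q \<in> the_set (apps a as)"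
  then show "has_run A (Suc m) q (cn t rs)"
    using truthD(4)[OF assms(1)] below_apps[OF assms(2) truths_in_sem] by blast
qed (use truthD[OF assms(1)] assms(3) in auto)

text \<open>Common core of the rules \<open>app\<close> and \<open>lam\<close>: by
  \<open>apps_lift\<close>, a state of \<open>apps a as\<close> has an \<open>F\<close>-transition
  into \<open>apps b as\<close>, from where runs of level \<open>m\<close> continue.\<close>

lemma has_run_lift:
  assumes fin: "finite (states A)" and F: "sym_arity A F = 1"
    and as: "as \<in> listset (map (sem A) (arg_tys \<rho>))"
    and below: "below A \<rho> a (lift A F \<rho> b)" and q: "q \<in> the_set (apps a as)"
    and runs: "\<And>q'. q' \<in> the_set (apps b as) \<Longrightarrow> has_run A m q' T"
  shows "has_run A (Suc m) q (Node F [T])"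
proof (rule has_run_Node1[OF _ F runs])
  show "q \<in> pre A F [the_set (apps b as)]"
    using below_apps[OF below as] q by (auto simp: apps_lift[OF fin as])
qed

section \<open>Soundness\<close>

text \<open>Maps replace the enumeration of the domain: both can be updated at a bound variable
  without renumbering, see \<open>realizes_upd\<close>.\<close>

definition realizes ::
  "('c, 'q) automaton \<Rightarrow> nat \<Rightarrow> ('v, 'q) ctx \<Rightarrow> ('v tvar \<rightharpoonup> ('v, 'c) ltree) \<Rightarrow> bool" where
  "realizes A l \<Gamma> \<theta> \<longleftrightarrow> dom \<theta> = dom \<Gamma> \<and>
     (\<forall>x \<sigma> b u. \<Gamma> (x, \<sigma>) = Some b \<longrightarrow> \<theta> (x, \<sigma>) = Some u \<longrightarrow> truth A l b u \<sigma>)"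

lemma realizes_truth:
  assumes "realizes A l \<Gamma> \<theta>" "\<theta> (x, \<sigma>) = Some u"
  shows "\<exists>b. \<Gamma> (x, \<sigma>) = Some b \<and> truth A l b u \<sigma>"
proof -
  have "(x, \<sigma>) \<in> dom \<Gamma>" using assms by (auto simp: realizes_def)
  then show ?thesis using assms by (auto simp: realizes_def)
qed

lemma realizes_mono: "realizes A n \<Gamma> \<theta> \<Longrightarrow> m \<le> n \<Longrightarrow> realizes A m \<Gamma> \<theta>"
  unfolding realizes_def by (meson truth_mono)

lemma realizes_upd:
  "realizes A l \<Gamma> \<theta> \<Longrightarrow> truth A l a r \<sigma> \<Longrightarrow>
    realizes A l (\<Gamma>((x, \<sigma>) \<mapsto> a)) (\<theta>((x, \<sigma>) \<mapsto> r))"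
  by (auto simp: realizes_def)

lemma realizes_closed: "realizes A l \<Gamma> \<theta> \<Longrightarrow> u \<in> ran \<theta> \<Longrightarrow> closed_tree u"
  by (auto simp: ran_def dest: realizes_truth truthD(3))

text \<open>Supplies the first three premises of \<open>truthI\<close> in the soundness
  proof.\<close>

lemma wf_judgement_subst:
  assumes "wf_judgement A \<Gamma> a t \<rho>" "realizes A l \<Gamma> \<theta>"
  shows "a \<in> sem A \<rho>" "typed A (subst \<theta> t) \<rho>" "closed_tree (subst \<theta> t)"
proof -
  show "a \<in> sem A \<rho>" using assms(1) by (simp add: wf_judgement_def)
  show "typed A (subst \<theta> t) \<rho>"
    by (rule typed_subst)
      (use assms in \<open>auto simp: wf_judgement_def dest: realizes_truth truthD(2)\<close>)
  show "closed_tree (subst \<theta> t)"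
    by (rule closed_subst)
      (use assms realizes_closed[OF assms(2)] in \<open>auto simp: wf_judgement_def realizes_def\<close>)
qed

text \<open>The level and the map are general in the induction: \<open>app\<close> and
  \<open>lam\<close> apply their hypotheses at a lower level, and \<open>lam\<close> with an updated
  map.\<close>

lemma derives_sound:
  fixes A :: "('c, 'q) automaton" and t :: "('v, 'c) ltree"
  assumes fin: "finite (states A)"
    and "derives A n \<Gamma> a t \<rho>" "l \<le> n" "realizes A l \<Gamma> \<theta>"
  shows "truth A l a (subst \<theta> t) \<rho>"
  using assms(2-)
proof (induction arbitrary: l \<theta> rule: derives.induct)
  case (zero \<Gamma> a t \<rho>)
  \<comment> \<open>Here \<open>l = 0\<close>, so no level \<open>Suc m\<close> is left to
    check.\<close>
  show ?case by (rule truthI) (use zero wf_judgement_subst[OF zero(1,3)] in auto)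
next
  case (var \<Gamma> a x \<rho> b n)
  then have "(x, \<rho>) \<in> dom \<theta>" by (auto simp: realizes_def)
  then obtain u where u: "\<theta> (x, \<rho>) = Some u" by blast
  then have "truth A l b u \<rho>" using var realizes_truth by fastforce
  then show ?case using var(1,3) u
    by (auto simp: subst_simps wf_judgement_def intro: truth_below)
next
  case (app \<Gamma> a \<sigma> s t f u n \<rho>)
  show ?case
  proof (rule truthI)
    fix m as q and rs :: "('v, 'c) ltree list"
    assume m: "Suc m \<le> l" and as: "truths A (Suc m) as rs (arg_tys \<sigma>)"
      and q: "q \<in> the_set (apps a as)"
    have "m \<le> n" and \<theta>: "realizes A m \<Gamma> \<theta>"
      using m app.prems(1) realizes_mono[OF app.prems(2), of m] by auto
    then have s: "truth A m f (subst \<theta> s) (Arr \<rho> \<sigma>)" and t: "truth A m u (subst \<theta> t) \<rho>"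
      using app.IH by blast+
    \<comment> \<open>The \<R>-step pushes the argument onto the list, so the truth of
      \<open>f\<close> is used at \<open>u # as\<close>; only \<open>m\<close> levels remain below
      the new node.\<close>
    have args: "truths A m (u # as) (subst \<theta> t # rs) (arg_tys (Arr \<rho> \<sigma>))"
      using t truths_mono[OF as] by simp
    show "has_run A (Suc m) q (cn (subst \<theta> (App \<sigma> s t)) rs)"
      unfolding subst_simps cn_simps
      by (rule has_run_lift[OF fin _ truths_in_sem[OF as] app.hyps(2) q])
        (use truthD(4)[OF s order_refl args] in auto)
  qed (use wf_judgement_subst[OF app.hyps(1) app.prems(2)] in auto)
next
  case (lam \<Gamma> f x \<rho> s \<sigma> n)
  show ?case
  proof (rule truthI)
    fix m as q and rs :: "('v, 'c) ltree list"
    assume m: "Suc m \<le> l" and args: "truths A (Suc m) as rs (arg_tys (Arr \<rho> \<sigma>))"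
      and q: "q \<in> the_set (apps f as)"
    obtain a as' r rs' where eq: "as = a # as'" "rs = r # rs'"
      and a: "truth A (Suc m) a r \<rho>" and as': "truths A (Suc m) as' rs' (arg_tys \<sigma>)"
      using args by (cases as; cases rs) auto
    have "m \<le> n" and \<theta>: "realizes A m (\<Gamma>((x, \<rho>) \<mapsto> a)) (\<theta>((x, \<rho>) \<mapsto> r))"
      using m lam.prems(1) realizes_upd[OF realizes_mono[OF lam.prems(2)] truth_mono[OF a]] by auto
    \<comment> \<open>The rule provides some \<open>b\<close> for each value; the one for the first
      argument \<open>a\<close> is taken.\<close>
    with lam.IH truthD(1)[OF a] obtain b where below: "below A \<sigma> (app f a) (lift A SymBeta \<sigma> b)"
      and b: "truth A m b (subst (\<theta>((x, \<rho>) \<mapsto> r)) s) \<sigma>"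
      by blast
    have "\<And>u. u \<in> ran (\<theta>((x, \<rho>) := None)) \<Longrightarrow> closed_tree u"
      using realizes_closed[OF lam.prems(2)] by (auto simp: ran_def split: if_splits)
    \<comment> \<open>Under the binder the bound variable is deleted from \<open>\<theta>\<close>;
      the \<beta>-step then inserts \<open>r\<close> for it, and composing both gives the updated
      map.\<close>
    moreover have "[(x, \<rho>) \<mapsto> r] ++ \<theta>((x, \<rho>) := None) = \<theta>((x, \<rho>) \<mapsto> r)"
      by (auto simp: map_add_def split: option.split)
    ultimately have body: "subst [(x, \<rho>) \<mapsto> r] (subst (\<theta>((x, \<rho>) := None)) s)
        = subst (\<theta>((x, \<rho>) \<mapsto> r)) s"
      by (simp add: subst_subst)
    show "has_run A (Suc m) q (cn (subst \<theta> (Lam (x, \<rho>) s)) rs)"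
      unfolding subst_simps cn_simps eq body
      by (rule has_run_lift[OF fin _ truths_in_sem[OF as'] below])
        (use q eq truthD(4)[OF b order_refl truths_mono[OF as']] in auto)
  qed (use wf_judgement_subst[OF lam.hyps(1) lam.prems(2)] in auto)
next
  case (con \<Gamma> f c n)
  show ?case
  proof (rule truthI)
    fix m as q and rs :: "('v, 'c) ltree list"
    assume "truths A (Suc m) as rs (arg_tys (letter_ty A c))" and q: "q \<in> the_set (apps f as)"
    then have len: "length as = arity A c" "length rs = arity A c"
      and args: "\<And>i. i < arity A c \<Longrightarrow> truth A (Suc m) (as ! i) (rs ! i) Iota"
      by (auto simp: truths_nth arg_tys_letter_ty)
    have "set as \<subseteq> sem A Iota"
      using truthD(1)[OF args] len(1) by (auto simp: in_set_conv_nth simp del: sem.simps)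
    \<comment> \<open>Values of type \<open>Iota\<close> are state sets wrapped in
      \<open>VSet\<close>; unwrapping them gives the vector to which the premise of rule
      \<open>con\<close> applies.\<close>
    then have as: "set (map the_set as) \<subseteq> Pow (states A)" "map VSet (map the_set as) = as"
      by (fastforce, auto intro!: map_idI)
    then have q_pre: "q \<in> pre A (Letter c) (map the_set as)"
      using con.hyps(2) len(1) q by (metis length_map subsetD)
    \<comment> \<open>An argument of type \<open>Iota\<close> takes no further arguments, so its
      truth speaks of \<open>cn\<close> with the empty list; the level \<open>Suc m\<close> is
      lowered to \<open>m\<close> for the children.\<close>
    have runs: "has_run A m q' (cn (rs ! i) [])"
      if "i < arity A c" "q' \<in> the_set (as ! i)" for i q'
      using truthD(4)[OF args, of i "Suc m" "[]" "[]" q'] that has_run_mono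
      by (fastforce simp: apps_def)
    show "has_run A (Suc m) q (cn (subst \<theta> (Con c)) rs)"
      unfolding subst_simps cn_simps by (rule has_run_Node[OF q_pre]) (use len runs in auto)
  qed (use wf_judgement_subst[OF con.hyps(1) con.prems(2)] in auto)
qed

theorem theorem7p5:
  fixes A :: "('c, 'q) automaton"
    and \<Gamma> :: "('v, 'q) ctx"
    and t :: "('v, 'c) ltree"
    and a :: "'q val" and \<rho> :: ty and n :: nat
    and xs :: "('v \<times> ty) list"
  assumes "trivial_automaton A"
    and "derives A n \<Gamma> a t \<rho>"
    and "distinct xs" and "dom \<Gamma> = set xs"
  shows "\<forall>l \<le> n. \<forall>ts :: ('v, 'c) ltree list.
    length ts = length xs \<longrightarrow>
    (\<forall>i < length xs. typed A (ts ! i) (snd (xs ! i)) \<and> closed_tree (ts ! i)) \<longrightarrow>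
    (\<forall>i < length xs. truth A l (the (\<Gamma> (xs ! i))) (ts ! i) (snd (xs ! i))) \<longrightarrow>
    truth A l a (subst (map_of (zip xs ts)) t) \<rho>"
proof (intro allI impI)
  fix l and ts :: "('v, 'c) ltree list"
  assume l: "l \<le> n" and len: "length ts = length xs"
    and truth: "\<forall>i < length xs. truth A l (the (\<Gamma> (xs ! i))) (ts ! i) (snd (xs ! i))"
  have "truth A l b u \<sigma>"
    if b: "\<Gamma> (x, \<sigma>) = Some b" and u: "map_of (zip xs ts) (x, \<sigma>) = Some u" for x \<sigma> b u
  proof -
    \<comment> \<open>Each binding of the substitution comes from a position \<open>i\<close> of the
      two lists, where the assumed truth applies.\<close>
    obtain i where "i < length xs" "xs ! i = (x, \<sigma>)" "ts ! i = u"
      using map_of_SomeD[OF u] len by (auto simp: in_set_zip)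
    then show ?thesis using truth b by force
  qed
  \<comment> \<open>As the lists have equal length, the substitution is defined exactly on
    \<open>set xs\<close>, the domain of \<open>\<Gamma>\<close>.\<close>
  then have "realizes A l \<Gamma> (map_of (zip xs ts))"
    using assms(4) len by (auto simp: realizes_def)
  then show "truth A l a (subst (map_of (zip xs ts)) t) \<rho>"
    using derives_sound assms(1,2) l by (auto simp: trivial_automaton_def)
qed

end
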